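(* Let $\epsilon>0$ and let $G_H$ be (the adjacency matrix of) a Hamiltonian simple directed graph on $n$ vertices. Consider $\max\langle G_H,Q\rangle$ over the finite set of $n!$ points $Q\in Q_t\cup Q_{nt}$. Then $\max\langle G_H,Q\rangle$ is $$\begin{cases} = n(1+\epsilon), & \text{attained for a } Q\in Q_t,\\ \le n(1+\epsilon)-\epsilon, & \text{may be attained for a } Q\in Q_{nt}.\end{cases}$$ Here the first line refers to the maximum over $Q\in Q_t$ and the second line to the maximum over $Q\in Q_{nt}$.
   Context: A simple directed graph on vertices $1,\dots,n$ has no loops and no multiple arcs; it is identified with its $n\times n$ $0/1$ adjacency matrix, which has zero diagonal. It is Hamiltonian if it contains a directed cycle through all $n$ vertices (a tour). For real $n\times n$ matrices, $\langle A,B\rangle=\sum_{i,j}A[i,j]B[i,j]$. $P$ is the set of all $n!$ permutation matrices of size $n\times n$. $P_t\subset P$ is the set of the $(n-1)!$ irreflexive (zero diagonal) permutation matrices which, viewed as adjacency matrices, are directed Hamilton cycles ("tours"), and $P_{nt}=P\setminus P_t$ ("non-tours"). Let $\overline{B_n}$ be the $n\times n$ matrix with all entries equal to $1/n$. Define $$Q_t=\{(1+\epsilon)X : X\in P_t\},\qquad Q_{nt}=\{X+\epsilon\,\overline{B_n} : X\in P_{nt}\}.$$ *)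

theory Defs
  imports "HOL-Analysis.Analysis" "Graph_Theory.Graph_Theory"
begin

text \<open>The vertex set is the finite index type \<open>'n\<close>, so \<open>n = CARD('n)\<close>. The pairing of two
  matrices is the inner product of \<open>real^'n^'n\<close>, which is the sum of all products of entries.\<close>

definition simple_adj_matrix :: "real^'n^'n \<Rightarrow> bool" where
  "simple_adj_matrix A \<longleftrightarrow> (\<forall>i j. A $ i $ j \<in> {0, 1}) \<and> (\<forall>i. A $ i $ i = 0)"

definition adj_digraph :: "real^'n^'n \<Rightarrow> ('n, 'n \<times> 'n) pre_digraph" where
  "adj_digraph A = with_proj \<lparr>pverts = UNIV, parcs = {(i, j). A $ i $ j = 1}\<rparr>"

text \<open>The vertices on a directed cycle are the tails of its arcs. A loop counts as a cycle of
  length one for \<^const>\<open>pre_digraph.cycle\<close>; below, the zero diagonals rule this out, so that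
  nothing is Hamiltonian, and there are no tours, on a single vertex.\<close>

definition hamilton_cycle :: "('a, 'b) pre_digraph \<Rightarrow> 'b list \<Rightarrow> bool" where
  "hamilton_cycle D p \<longleftrightarrow> pre_digraph.cycle D p \<and> tail D ` set p = verts D"

definition hamiltonian :: "('a, 'b) pre_digraph \<Rightarrow> bool" where
  "hamiltonian D \<longleftrightarrow> (\<exists>p. hamilton_cycle D p)"

definition perm_matrices :: "(real^'n^'n) set" where
  "perm_matrices = {(\<chi> i j. if j = \<sigma> i then 1 else 0) | \<sigma>. \<sigma> permutes UNIV}"

definition tours :: "(real^'n^'n) set" where
  "tours = {X \<in> perm_matrices. (\<forall>i. X $ i $ i = 0) \<and>
     (\<exists>p. hamilton_cycle (adj_digraph X) p \<and> set p = arcs (adj_digraph X))}"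

definition non_tours :: "(real^'n^'n) set" where
  "non_tours = perm_matrices - tours"

definition B_bar :: "real^'n^'n" where
  "B_bar = (\<chi> i j. 1 / real CARD('n))"

definition Q_t :: "real \<Rightarrow> (real^'n^'n) set" where
  "Q_t \<epsilon> = {(1 + \<epsilon>) *\<^sub>R X | X. X \<in> tours}"

definition Q_nt :: "real \<Rightarrow> (real^'n^'n) set" where
  "Q_nt \<epsilon> = {X + \<epsilon> *\<^sub>R B_bar | X. X \<in> non_tours}"

text \<open>These facts make \<^const>\<open>Max\<close> meaningful on the values over \<^const>\<open>Q_t\<close> and
  \<^const>\<open>Q_nt\<close>; \<^const>\<open>Q_t\<close> is nonempty as soon as a Hamiltonian simple digraph exists.\<close>

lemma finite_perm_matrices: "finite (perm_matrices :: (real^'n^'n) set)"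
proof -
  have "perm_matrices = (\<lambda>\<sigma>. (\<chi> i j. if j = \<sigma> i then 1 else 0) :: real^'n^'n) ` {\<sigma> :: 'n \<Rightarrow> 'n. \<sigma> permutes UNIV}"
    by (auto simp: perm_matrices_def)
  then show ?thesis by (metis finite_imageI finite_permutations finite)
qed

lemma finite_Q_t: "finite (Q_t \<epsilon> :: (real^'n^'n) set)"
proof -
  have "Q_t \<epsilon> = (\<lambda>X. (1 + \<epsilon>) *\<^sub>R X) ` (tours :: (real^'n^'n) set)"
    by (auto simp: Q_t_def)
  moreover have "finite (tours :: (real^'n^'n) set)"
    by (rule finite_subset[OF _ finite_perm_matrices]) (auto simp: tours_def)
  ultimately show ?thesis by simp
qed

lemma finite_Q_nt: "finite (Q_nt \<epsilon> :: (real^'n^'n) set)"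
proof -
  have "Q_nt \<epsilon> = (\<lambda>X. X + \<epsilon> *\<^sub>R B_bar) ` (non_tours :: (real^'n^'n) set)"
    by (auto simp: Q_nt_def)
  then show ?thesis
    by (simp add: non_tours_def finite_perm_matrices)
qed

lemma Q_nt_nonempty: "(Q_nt \<epsilon> :: (real^'n^'n) set) \<noteq> {}"
proof -
  let ?I = "(\<chi> i j. if j = id i then 1 else 0) :: real^'n^'n"
  have "?I \<in> perm_matrices"
    unfolding perm_matrices_def using permutes_id by blast
  moreover have "?I \<notin> tours"
    by (simp add: tours_def)
  ultimately show ?thesis
    by (auto simp: Q_nt_def non_tours_def)
qed

end

theory Submission
  imports Defs "HOL-Combinatorics.Cycles"
begin

text \<open>Every permutation matrix pairs with a \<open>0/1\<close> matrix to at most \<open>n\<close>, and a Hamilton cycle of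
  the graph attains \<open>n\<close>. Since the diagonal is zero, the \<open>n\<^sup>2 - n\<close> remaining entries bound the
  pairing with \<open>B_bar\<close> by \<open>n - 1\<close>, which leaves the gap \<open>\<epsilon>\<close>. For \<open>n \<ge> 4\<close> the complete digraph
  attains it, with gap exactly \<open>\<epsilon>\<close>: a product of derangements of two complementary sets of size at
  least two is a fixed-point free non-tour.\<close>

section \<open>Permutation matrices and closed walks in adjacency digraphs\<close>

definition perm_matrix :: "('n \<Rightarrow> 'n) \<Rightarrow> real^'n^'n" where
  "perm_matrix \<sigma> = (\<chi> i j. if j = \<sigma> i then 1 else 0)"

lemma perm_matrices_eq: "perm_matrices = {perm_matrix \<sigma> | \<sigma>. \<sigma> permutes UNIV}"
  by (simp add: perm_matrices_def perm_matrix_def)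

lemma perm_matrix_nth [simp]: "perm_matrix \<sigma> $ i $ j = (if j = \<sigma> i then 1 else 0)"
  by (simp add: perm_matrix_def)

lemma adj_digraph_simps [simp]:
  "verts (adj_digraph A) = UNIV"
  "arcs (adj_digraph A) = {(i, j). A $ i $ j = 1}"
  "tail (adj_digraph A) = fst"
  "head (adj_digraph A) = snd"
  by (simp_all add: adj_digraph_def with_proj_def)

text \<open>Dropping the start of the vertex list leaves the heads, so the distinctness demanded by
  \<open>cycle\<close> becomes distinctness of \<open>map snd p\<close>.\<close>

lemma cas_awalk_verts:
  assumes "pre_digraph.cas D u p v"
  shows "pre_digraph.awalk_verts D u p = u # map (head D) p"
  using assms
  by (induction p arbitrary: u) (auto simp: pre_digraph.cas.simps pre_digraph.awalk_verts.simps)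

lemma cas_tails_heads:
  assumes "pre_digraph.cas D u p v"
  shows "map (tail D) p @ [v] = u # map (head D) p"
  using assms by (induction p arbitrary: u) (auto simp: pre_digraph.cas.simps)

lemma cas_adj_digraph_zip: "pre_digraph.cas (adj_digraph A) u (zip (u # xs) (xs @ [v])) v"
  by (induction xs arbitrary: u) (auto simp: pre_digraph.cas.simps)

text \<open>\<open>cas\<close> looks only at \<open>tail\<close> and \<open>head\<close>, which are
  \<open>fst\<close> and \<open>snd\<close> for every matrix. This lets a cycle of the graph be
  reread in the digraph of a permutation matrix.\<close>

lemma cas_adj_digraph_cong:
  "pre_digraph.cas (adj_digraph A) u p v \<longleftrightarrow> pre_digraph.cas (adj_digraph B) u p v"
  by (induction p arbitrary: u) (auto simp: pre_digraph.cas.simps)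

lemma cycle_adj_digraph_iff:
  "pre_digraph.cycle (adj_digraph A) p \<longleftrightarrow>
    (\<exists>u. pre_digraph.cas (adj_digraph A) u p u) \<and> (\<forall>(i, j)\<in>set p. A $ i $ j = 1)
    \<and> distinct (map snd p) \<and> p \<noteq> []"
proof -
  have "set p \<subseteq> {(i, j). A $ i $ j = 1} \<longleftrightarrow> (\<forall>(i, j)\<in>set p. A $ i $ j = 1)"
    by auto
  then show ?thesis
    by (auto simp: pre_digraph.cycle_def pre_digraph.awalk_def cas_awalk_verts)
qed

section \<open>Hamilton cycles as permutations\<close>

text \<open>Every vertex is the tail of exactly one arc, so the arcs form the graph of a function;
  distinct heads make it injective, hence bijective on the finite vertex set.\<close>

lemma hamilton_cycle_adj_digraph_permutes:
  assumes "hamilton_cycle (adj_digraph A) p"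
  obtains \<sigma> where "\<sigma> permutes UNIV" and "set p = {(i, j). j = \<sigma> i}"
proof -
  from assms obtain u where u: "pre_digraph.cas (adj_digraph A) u p u"
    and d: "distinct (map snd p)" and ne: "p \<noteq> []" and fst: "fst ` set p = UNIV"
    by (auto simp: hamilton_cycle_def cycle_adj_digraph_iff)
  \<comment> \<open>The walk is closed, so \<open>u\<close> cancels: tails and heads agree as
    multisets, and distinctness passes from the heads to the tails.\<close>
  from cas_tails_heads[OF u] have "mset (map fst p @ [u]) = mset (u # map snd p)"
    by simp
  then have "mset (map fst p) = mset (map snd p)"
    by simp
  with d have df: "distinct (map fst p)"
    by (metis mset_eq_imp_distinct_iff)
  define \<sigma> where "\<sigma> i = (THE j. (i, j) \<in> set p)" for i
  have mem: "(i, j) \<in> set p \<longleftrightarrow> j = \<sigma> i" for i j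
  proof -
    have "i \<in> fst ` set p"
      by (simp add: fst)
    then obtain k where k: "(i, k) \<in> set p"
      by auto
    then have *: "j = k" if "(i, j) \<in> set p" for j
      using eq_key_imp_eq_value[OF df that] by simp
    then have "\<sigma> i = k"
      unfolding \<sigma>_def using k by (intro the_equality)
    with k * show ?thesis
      by blast
  qed
  have "inj \<sigma>"
  proof (rule injI)
    fix x y assume "\<sigma> x = \<sigma> y"
    moreover have "inj_on snd (set p)"
      using d by (simp add: distinct_map)
    moreover have "(x, \<sigma> x) \<in> set p" "(y, \<sigma> y) \<in> set p"
      by (simp_all add: mem)
    ultimately show "x = y"
      by (metis inj_onD prod.inject snd_conv)
  qed
  then have "bij \<sigma>"
    by (simp add: bij_def finite_UNIV_inj_surj)
  then have "\<sigma> permutes UNIV"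
    by (rule bij_imp_permutes) simp
  with mem show thesis
    by (intro that[of \<sigma>]) auto
qed

text \<open>The same arc list \<open>p\<close> is the witness: it consists of exactly the arcs of
  \<open>perm_matrix \<sigma>\<close>, and the zero diagonal of \<open>A\<close> keeps \<sigma> free
  of fixed points.\<close>

lemma perm_matrix_tour:
  assumes "hamilton_cycle (adj_digraph A) p" and "set p = {(i, j). j = \<sigma> i}"
    and "\<sigma> permutes UNIV" and "\<And>i. A $ i $ i = 0"
  shows "perm_matrix \<sigma> \<in> tours"
proof -
  have A: "A $ i $ \<sigma> i = 1" for i
    using assms(1,2) by (auto simp: hamilton_cycle_def cycle_adj_digraph_iff)
  then have "\<sigma> i \<noteq> i" for i
    using assms(4)[of i] by (metis zero_neq_one)
  then have "perm_matrix \<sigma> $ i $ i = 0" for i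
    by (metis perm_matrix_nth)
  moreover have "arcs (adj_digraph (perm_matrix \<sigma>)) = set p"
    by (auto simp: assms(2) split: if_splits)
  moreover have "hamilton_cycle (adj_digraph (perm_matrix \<sigma>)) p"
    using assms(1,2) cas_adj_digraph_cong[of A _ p _ "perm_matrix \<sigma>"]
    by (auto simp: hamilton_cycle_def cycle_adj_digraph_iff)
  ultimately show ?thesis
    using assms(3) by (auto simp: tours_def perm_matrices_eq)
qed

section \<open>Invariant vertex sets and non-tours\<close>

text \<open>A walk that has entered \<open>S\<close> never leaves it.\<close>

lemma cas_closed_end:
  assumes "pre_digraph.cas D u p v" and "\<And>e. e \<in> set p \<Longrightarrow> tail D e \<in> S \<Longrightarrow> head D e \<in> S"
    and "u \<in> S \<or> (\<exists>e\<in>set p. tail D e \<in> S)"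
  shows "v \<in> S"
  using assms by (induction p arbitrary: u) (auto simp: pre_digraph.cas.simps)

lemma cas_closed_tails:
  assumes "pre_digraph.cas D u p v" and "\<And>e. e \<in> set p \<Longrightarrow> tail D e \<in> S \<Longrightarrow> head D e \<in> S"
    and "u \<in> S"
  shows "tail D ` set p \<subseteq> S"
  using assms by (induction p arbitrary: u) (auto simp: pre_digraph.cas.simps)

lemma perm_matrix_not_tour:
  assumes "a \<in> S" and "S \<noteq> UNIV" and "\<And>i. i \<in> S \<Longrightarrow> \<sigma> i \<in> S"
  shows "perm_matrix \<sigma> \<notin> tours"
proof
  let ?D = "adj_digraph (perm_matrix \<sigma>)"
  assume "perm_matrix \<sigma> \<in> tours"
  then obtain p where p: "hamilton_cycle ?D p" "set p = arcs ?D"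
    by (auto simp: tours_def)
  then obtain u where u: "pre_digraph.cas ?D u p u" and tails: "fst ` set p = UNIV"
    by (auto simp: hamilton_cycle_def cycle_adj_digraph_iff)
  have closed: "head ?D e \<in> S" if "e \<in> set p" "tail ?D e \<in> S" for e
    using that p(2) assms(3) by (auto split: if_splits)
  have "\<exists>e\<in>set p. tail ?D e \<in> S"
    using tails assms(1) by (auto simp: p(2) intro!: exI[of _ a])
  \<comment> \<open>The cycle meets \<open>S\<close> and so ends in \<open>S\<close>. Being closed,
    it also starts there, which confines all its tails to the proper subset
    \<open>S\<close>.\<close>
  with cas_closed_end[OF u closed] have "u \<in> S"
    by blast
  with cas_closed_tails[OF u closed] tails assms(2) show False
    by auto
qed

section \<open>The complete digraph and fixed-point free non-tours\<close>

text \<open>Any enumeration of the vertices, closed up at its end, is a Hamilton cycle. Only loops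
  must be excluded, and two vertices suffice for that.\<close>

lemma hamiltonian_complete:
  assumes "CARD('n) \<ge> 2"
  shows "hamiltonian (adj_digraph ((\<chi> i j. if i = j then 0 else 1) :: real^'n^'n))"
proof -
  let ?K = "(\<chi> i j. if i = j then 0 else 1) :: real^'n^'n"
  obtain vs :: "'n list" where vs: "distinct vs" "set vs = UNIV"
    using finite_distinct_list[OF finite] by blast
  then have "length vs \<ge> 2"
    using assms by (metis distinct_card)
  then obtain u xs where u: "vs = u # xs" "xs \<noteq> []"
    by (cases vs; cases "tl vs") auto
  define p where "p = zip (u # xs) (xs @ [u])"
  have tails: "map fst p = vs" and heads: "map snd p = xs @ [u]"
    by (simp_all add: p_def u)
  have "i \<noteq> j" if "(i, j) \<in> set p" for i j
  proof -
    obtain k where k: "k < length vs" "i = (u # xs) ! k" "j = (xs @ [u]) ! k"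
      using \<open>(i, j) \<in> set p\<close> by (auto simp: p_def u set_zip)
    \<comment> \<open>An arc either joins successive entries of \<open>vs\<close> or is the closing
      arc back to \<open>u\<close>; the latter starts in \<open>xs\<close> because \<open>xs\<close>
      is nonempty.\<close>
    show ?thesis
    proof (cases "k < length xs")
      case True
      then have "i = vs ! k" "j = vs ! Suc k" "Suc k < length vs"
        by (simp_all add: k u(1) nth_append)
      then show ?thesis
        using k(1) nth_eq_iff_index_eq[OF vs(1)] by simp
    next
      case False
      with k u have "k = length xs" "j = u"
        by (auto simp: nth_append)
      moreover have "i \<in> set xs"
        using False k u by (cases k) auto
      ultimately show ?thesis
        using vs(1) u by auto
    qed
  qed
  then have "pre_digraph.cycle (adj_digraph ?K) p"
    using cas_adj_digraph_zip[of ?K u xs u] vs u heads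
    by (auto simp: cycle_adj_digraph_iff p_def)
  moreover have "fst ` set p = UNIV"
    using tails vs(2) by (metis set_map)
  ultimately show ?thesis
    by (auto simp: hamiltonian_def hamilton_cycle_def)
qed

lemma ex_derangement:
  assumes "finite S" and "card S \<ge> 2"
  obtains \<sigma> where "\<sigma> permutes S" and "\<And>i. i \<in> S \<Longrightarrow> \<sigma> i \<noteq> i"
proof -
  obtain xs where xs: "distinct xs" "set xs = S"
    using finite_distinct_list[OF assms(1)] by blast
  then have len: "length xs \<ge> 2"
    using assms(2) by (metis distinct_card)
  \<comment> \<open>The cycle sends each entry of \<open>xs\<close> to the next one, cyclically;
    with at least two distinct entries nothing stays fixed.\<close>
  have rot: "map (cycle_of_list xs) xs = rotate1 xs"
    using cyclic_rotation[OF xs(1), of 1] by simp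
  have "cycle_of_list xs i \<noteq> i" if "i \<in> S" for i
  proof
    assume fixed: "cycle_of_list xs i = i"
    obtain k where k: "k < length xs" "i = xs ! k"
      using \<open>i \<in> S\<close> xs(2) by (auto simp: in_set_conv_nth)
    have "xs ! k = map (cycle_of_list xs) xs ! k"
      using fixed by (simp only: k nth_map)
    also have "\<dots> = xs ! (Suc k mod length xs)"
      by (simp only: rot nth_rotate1[OF k(1)])
    finally have "xs ! k = xs ! (Suc k mod length xs)" .
    moreover have "Suc k mod length xs < length xs"
      using len by (intro mod_less_divisor) auto
    ultimately have "k = Suc k mod length xs"
      using nth_eq_iff_index_eq[OF xs(1) k(1)] by simp
    \<comment> \<open>Without wrap-around the index grows by one; with wrap-around it becomes 0,
      which would force \<open>length xs = 1\<close>.\<close>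
    with k len show False
      by (cases "Suc k = length xs") auto
  qed
  with cycle_permutes[of xs] xs(2) that show thesis
    by metis
qed

text \<open>Four is the smallest possible size: on fewer vertices every derangement is a single
  cycle.\<close>

lemma ex_non_tour_derangement:
  assumes "CARD('n::finite) \<ge> 4"
  obtains \<sigma> :: "'n::finite \<Rightarrow> 'n" where "perm_matrix \<sigma> \<in> non_tours" and "\<And>i. \<sigma> i \<noteq> i"
proof -
  obtain S :: "'n set" where S: "card S = 2"
    using obtain_subset_with_card_n[of 2 "UNIV :: 'n set"] assms by auto
  have "card (- S) \<ge> 2"
    using assms S by (simp add: Compl_eq_Diff_UNIV card_Diff_subset)
  obtain \<sigma> where \<sigma>: "\<sigma> permutes S" "\<And>i. i \<in> S \<Longrightarrow> \<sigma> i \<noteq> i"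
    using ex_derangement[of S] S by auto
  obtain \<tau> where \<tau>: "\<tau> permutes - S" "\<And>i. i \<in> - S \<Longrightarrow> \<tau> i \<noteq> i"
    using ex_derangement[of "- S"] \<open>card (- S) \<ge> 2\<close> by auto
  \<comment> \<open>The supports are disjoint: \<tau> is the identity on \<open>S\<close> and maps
    \<open>- S\<close> to itself, where \<sigma> is the identity.\<close>
  have on: "(\<sigma> \<circ> \<tau>) i = (if i \<in> S then \<sigma> i else \<tau> i)" for i
    using \<sigma>(1) \<tau>(1) by (auto simp: permutes_not_in permutes_in_image
        dest: permutes_in_image[THEN iffD2, of \<tau> "- S" i])
  have "(\<sigma> \<circ> \<tau>) permutes UNIV"
    using \<sigma>(1) \<tau>(1) by (meson permutes_compose permutes_subset subset_UNIV)
  moreover have "perm_matrix (\<sigma> \<circ> \<tau>) \<notin> tours"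
  proof -
    obtain a where "a \<in> S"
      using S by (metis card.empty equals0I zero_neq_numeral)
    moreover have "S \<noteq> UNIV"
      using S assms by auto
    ultimately show ?thesis
      by (rule perm_matrix_not_tour) (simp only: on if_True permutes_in_image[OF \<sigma>(1)])
  qed
  ultimately have "perm_matrix (\<sigma> \<circ> \<tau>) \<in> non_tours"
    by (auto simp: non_tours_def perm_matrices_eq)
  moreover have "(\<sigma> \<circ> \<tau>) i \<noteq> i" for i
    using on \<sigma>(2) \<tau>(2) by auto
  ultimately show thesis
    by (rule that)
qed

section \<open>Pairings with permutation matrices and with \<open>B_bar\<close>\<close>

lemma inner_perm_matrix: "inner A (perm_matrix \<sigma>) = (\<Sum>i\<in>UNIV. A $ i $ \<sigma> i)"
  by (simp add: inner_vec_def if_distrib[of "\<lambda>x. _ * x"] cong: if_cong)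

lemma inner_B_bar: "inner (A :: real^'n^'n) B_bar = (\<Sum>i\<in>UNIV. \<Sum>j\<in>UNIV. A $ i $ j) / real CARD('n)"
  by (simp add: inner_vec_def B_bar_def sum_divide_distrib)

lemma simple_adj_matrix_le_1:
  assumes "simple_adj_matrix A"
  shows "A $ i $ j \<le> 1"
  using assms unfolding simple_adj_matrix_def by (metis insertE less_eq_real_def singletonD zero_le_one)

lemma sum_off_diagonal: "(\<Sum>j\<in>UNIV. if i = j then 0 else 1) = real CARD('n) - 1" for i :: "'n::finite"
proof -
  have "(\<Sum>j\<in>UNIV. if i = j then 0 else 1) = (\<Sum>j\<in>UNIV - {i}. 1 :: real)"
    by (rule sum.mono_neutral_cong_right) auto
  also have "\<dots> = real CARD('n) - 1"
    by (simp add: card_Diff_singleton of_nat_diff Suc_leI)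
  finally show ?thesis .
qed

lemma inner_perm_matrix_le:
  fixes A :: "real^'n^'n"
  assumes "simple_adj_matrix A"
  shows "inner A (perm_matrix \<sigma>) \<le> real CARD('n)"
  unfolding inner_perm_matrix
  using sum_bounded_above[of UNIV "\<lambda>i. A $ i $ \<sigma> i" 1] simple_adj_matrix_le_1[OF assms] by simp

lemma inner_B_bar_le:
  fixes A :: "real^'n^'n"
  assumes "simple_adj_matrix A"
  shows "inner A B_bar \<le> real CARD('n) - 1"
proof -
  have "A $ i $ j \<le> (if i = j then 0 else 1)" for i j
    using assms simple_adj_matrix_le_1[OF assms, of i j] by (auto simp: simple_adj_matrix_def)
  then have "(\<Sum>i\<in>UNIV. \<Sum>j\<in>UNIV. A $ i $ j) \<le> (\<Sum>i\<in>(UNIV :: 'n set). \<Sum>j\<in>(UNIV :: 'n set). if i = j then 0 else 1)"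
    by (intro sum_mono)
  also have "\<dots> = real CARD('n) * (real CARD('n) - 1)"
    by (simp add: sum_off_diagonal)
  finally show ?thesis
    by (simp add: inner_B_bar divide_le_eq mult.commute)
qed

section \<open>Bounds over the two point sets and their attainment\<close>

lemma inner_Q_t_le:
  fixes A :: "real^'n^'n"
  assumes "simple_adj_matrix A" and "\<epsilon> > 0" and "Q \<in> Q_t \<epsilon>"
  shows "inner A Q \<le> real CARD('n) * (1 + \<epsilon>)"
proof -
  obtain \<sigma> where "Q = (1 + \<epsilon>) *\<^sub>R perm_matrix \<sigma>"
    using assms(3) by (auto simp: Q_t_def tours_def perm_matrices_eq)
  then show ?thesis
    using inner_perm_matrix_le[OF assms(1), of \<sigma>] assms(2) by (simp add: mult.commute)
qed

lemma inner_Q_nt_le: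
  fixes A :: "real^'n^'n"
  assumes "simple_adj_matrix A" and "\<epsilon> > 0" and "Q \<in> Q_nt \<epsilon>"
  shows "inner A Q \<le> real CARD('n) * (1 + \<epsilon>) - \<epsilon>"
proof -
  obtain \<sigma> where "Q = perm_matrix \<sigma> + \<epsilon> *\<^sub>R B_bar"
    using assms(3) by (auto simp: Q_nt_def non_tours_def perm_matrices_eq)
  \<comment> \<open>Together with at most \<open>n\<close> from the permutation part this gives
    \<open>n + \<epsilon> * (n - 1)\<close>, which is the claimed bound.\<close>
  moreover have "\<epsilon> * inner A B_bar \<le> \<epsilon> * (real CARD('n) - 1)"
    using inner_B_bar_le[OF assms(1)] assms(2) by simp
  ultimately show ?thesis
    using inner_perm_matrix_le[OF assms(1), of \<sigma>] by (simp add: inner_add_right algebra_simps)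
qed

text \<open>The permutation read off a Hamilton cycle of the graph picks an entry 1 in every
  row.\<close>

lemma ex_Q_t_inner_eq:
  fixes A :: "real^'n^'n"
  assumes "simple_adj_matrix A" and "hamiltonian (adj_digraph A)"
  shows "\<exists>Q\<in>Q_t \<epsilon>. inner A Q = real CARD('n) * (1 + \<epsilon>)"
proof -
  obtain p where p: "hamilton_cycle (adj_digraph A) p"
    using assms(2) by (auto simp: hamiltonian_def)
  then obtain \<sigma> where \<sigma>: "\<sigma> permutes UNIV" "set p = {(i, j). j = \<sigma> i}"
    by (rule hamilton_cycle_adj_digraph_permutes)
  have "A $ i $ \<sigma> i = 1" for i
    using p \<sigma>(2) by (auto simp: hamilton_cycle_def cycle_adj_digraph_iff)
  then have "inner A ((1 + \<epsilon>) *\<^sub>R perm_matrix \<sigma>) = real CARD('n) * (1 + \<epsilon>)"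
    by (simp add: inner_perm_matrix)
  moreover have "perm_matrix \<sigma> \<in> tours"
    using perm_matrix_tour[OF p \<sigma>(2,1)] assms(1) by (simp add: simple_adj_matrix_def)
  ultimately show ?thesis
    by (auto simp: Q_t_def)
qed

text \<open>This is the sense in which the non-tour bound may be attained: by some graph of each
  size from four on. The complete digraph makes both summands of the estimate equalities.\<close>

lemma ex_Q_nt_inner_eq:
  assumes "CARD('n::finite) \<ge> 4"
  shows "\<exists>H :: real^'n^'n. simple_adj_matrix H \<and> hamiltonian (adj_digraph H)
    \<and> (\<exists>Q\<in>Q_nt \<epsilon>. inner H Q = real CARD('n) * (1 + \<epsilon>) - \<epsilon>)"
proof -
  let ?K = "(\<chi> i j. if i = j then 0 else 1) :: real^'n^'n"
  obtain \<sigma> :: "'n \<Rightarrow> 'n" where \<sigma>: "perm_matrix \<sigma> \<in> non_tours" "\<And>i. \<sigma> i \<noteq> i"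
    using ex_non_tour_derangement[OF assms] by blast
  have "inner ?K (perm_matrix \<sigma>) = real CARD('n)"
    using \<sigma>(2) by (simp add: inner_perm_matrix eq_commute[of _ "\<sigma> _"])
  moreover have "inner ?K B_bar = real CARD('n) - 1"
    by (simp add: inner_B_bar sum_off_diagonal)
  ultimately have "inner ?K (perm_matrix \<sigma> + \<epsilon> *\<^sub>R B_bar) = real CARD('n) * (1 + \<epsilon>) - \<epsilon>"
    by (simp only: inner_add_right inner_scaleR_right) (simp add: algebra_simps)
  moreover have "perm_matrix \<sigma> + \<epsilon> *\<^sub>R B_bar \<in> Q_nt \<epsilon>"
    using \<sigma>(1) by (auto simp: Q_nt_def)
  moreover have "simple_adj_matrix ?K"
    by (simp add: simple_adj_matrix_def)
  moreover have "hamiltonian (adj_digraph ?K)"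
    using assms by (intro hamiltonian_complete) simp
  ultimately show ?thesis
    by blast
qed

theorem theorem2p1:
  fixes G\<^sub>H :: "real^'n^'n" and \<epsilon> :: real
  assumes "\<epsilon> > 0"
    and "simple_adj_matrix G\<^sub>H"
    and "hamiltonian (adj_digraph G\<^sub>H)"
  shows "Max ((\<lambda>Q. inner G\<^sub>H Q) ` Q_t \<epsilon>) = real CARD('n) * (1 + \<epsilon>)
    \<and> (\<exists>Q \<in> Q_t \<epsilon>. inner G\<^sub>H Q = real CARD('n) * (1 + \<epsilon>))
    \<and> Max ((\<lambda>Q. inner G\<^sub>H Q) ` Q_nt \<epsilon>) \<le> real CARD('n) * (1 + \<epsilon>) - \<epsilon>
    \<and> Max ((\<lambda>Q. inner G\<^sub>H Q) ` (Q_t \<epsilon> \<union> Q_nt \<epsilon>)) = real CARD('n) * (1 + \<epsilon>)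
    \<and> (CARD('n) \<ge> 4 \<longrightarrow>
        (\<exists>H :: real^'n^'n. simple_adj_matrix H \<and> hamiltonian (adj_digraph H)
          \<and> (\<exists>Q \<in> Q_nt \<epsilon>. inner H Q = real CARD('n) * (1 + \<epsilon>) - \<epsilon>)))"
proof -
  let ?n = "real CARD('n)" and ?f = "\<lambda>Q. inner G\<^sub>H Q"
  obtain Q where Q: "Q \<in> Q_t \<epsilon>" "?f Q = ?n * (1 + \<epsilon>)"
    using ex_Q_t_inner_eq[OF assms(2,3)] by blast
  note t = inner_Q_t_le[OF assms(2,1)] and nt = inner_Q_nt_le[OF assms(2,1)]
  have "Max (?f ` Q_t \<epsilon>) = ?n * (1 + \<epsilon>)"
    using Q t by (intro Max_eqI) (auto simp: finite_Q_t intro: rev_image_eqI)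
  moreover have "Max (?f ` Q_nt \<epsilon>) \<le> ?n * (1 + \<epsilon>) - \<epsilon>"
    using nt by (intro Max.boundedI) (auto simp: finite_Q_nt Q_nt_nonempty)
  moreover have "Max (?f ` (Q_t \<epsilon> \<union> Q_nt \<epsilon>)) = ?n * (1 + \<epsilon>)"
  proof (rule Max_eqI)
    show "finite (?f ` (Q_t \<epsilon> \<union> Q_nt \<epsilon>))"
      by (simp add: finite_Q_t finite_Q_nt)
    \<comment> \<open>Non-tour values lie below the tour maximum because \<epsilon> is
      positive.\<close>
    show "y \<le> ?n * (1 + \<epsilon>)" if "y \<in> ?f ` (Q_t \<epsilon> \<union> Q_nt \<epsilon>)" for y
      using that assms(1) by (auto dest!: t nt)
    show "?n * (1 + \<epsilon>) \<in> ?f ` (Q_t \<epsilon> \<union> Q_nt \<epsilon>)"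
      using Q by (auto intro: rev_image_eqI)
  qed
  ultimately show ?thesis
    using Q ex_Q_nt_inner_eq by blast
qed

end
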